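(* Let $P(X)=\sum_{i=0}^{m} A_iX^i$ be a polynomial over FDDSs. If no non-constant coefficient $A_i$ ($i\ge 1$) of $P$ contains a dendron, then $P$ is not injective, i.e. there exist FDDSs $X\ne Y$ with $P(X)=P(Y)$.
   Context: An FDDS is a finite set with a total function on it, viewed as a functional digraph up to isomorphism. Sum is disjoint union and product is the direct product of digraphs (vertex set $V(A)\times V(B)$, arc $(u,u')\to(v,v')$ iff $u\to v$ and $u'\to v'$); $X^0$ is the single fixed point. A dendron is a connected FDDS whose unique cycle has length $1$; "$A$ contains a dendron" means some connected component of $A$ is a dendron. *)

theory Defs
  imports
    "HOL-Library.Nat_Bijection"
    "HOL-Library.FuncSet"
    "HOL-Combinatorics.Orbits"
    "HOL-Computational_Algebra.Polynomial"
begin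

text \<open>In \<^term>\<open>(V, f)\<close> only the values of \<^term>\<open>f\<close> on \<^term>\<open>V\<close> are meaningful. The empty system
  is admitted; it is the zero of the semiring below.\<close>

type_synonym 'a fsys = "'a set \<times> ('a \<Rightarrow> 'a)"

definition wf_fsys :: "'a fsys \<Rightarrow> bool" where
  "wf_fsys F \<longleftrightarrow> finite (fst F) \<and> snd F \<in> fst F \<rightarrow> fst F"

definition arc :: "'a fsys \<Rightarrow> 'a \<Rightarrow> 'a \<Rightarrow> bool" where
  "arc F u v \<longleftrightarrow> u \<in> fst F \<and> v = snd F u"

definition fsys_iso :: "'a fsys \<Rightarrow> 'b fsys \<Rightarrow> bool" where
  "fsys_iso F G \<longleftrightarrow> (\<exists>h. bij_betw h (fst F) (fst G) \<and>
     (\<forall>u\<in>fst F. \<forall>v\<in>fst F. arc F u v \<longleftrightarrow> arc G (h u) (h v)))"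

definition fsys_sum :: "'a fsys \<Rightarrow> 'b fsys \<Rightarrow> ('a + 'b) fsys" where
  "fsys_sum F G = (fst F <+> fst G, map_sum (snd F) (snd G))"

definition fsys_prod :: "'a fsys \<Rightarrow> 'b fsys \<Rightarrow> ('a \<times> 'b) fsys" where
  "fsys_prod F G = (fst F \<times> fst G, map_prod (snd F) (snd G))"

lemma arc_fsys_sum:
  "arc (fsys_sum F G) x y \<longleftrightarrow>
     (\<exists>u v. x = Inl u \<and> y = Inl v \<and> arc F u v) \<or> (\<exists>u v. x = Inr u \<and> y = Inr v \<and> arc G u v)"
  by (auto simp: arc_def fsys_sum_def)

lemma arc_fsys_prod:
  "arc (fsys_prod F G) (u, u') (v, v') \<longleftrightarrow> arc F u v \<and> arc G u' v'"
  by (auto simp: arc_def fsys_prod_def)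

lemma fsys_isoI:
  assumes "bij_betw h (fst F) (fst G)" "\<And>u. u \<in> fst F \<Longrightarrow> snd F u \<in> fst F"
    "\<And>u. u \<in> fst F \<Longrightarrow> h (snd F u) = snd G (h u)"
  shows "fsys_iso F G"
proof -
  have "arc F u v \<longleftrightarrow> arc G (h u) (h v)" if "u \<in> fst F" "v \<in> fst F" for u v
    using that assms unfolding arc_def by (metis bij_betwE bij_betw_imp_inj_on inj_onD)
  then show ?thesis using assms(1) unfolding fsys_iso_def by blast
qed

lemma fsys_isoE:
  assumes "fsys_iso F G" "wf_fsys F"
  obtains h where "bij_betw h (fst F) (fst G)" "\<And>u. u \<in> fst F \<Longrightarrow> h (snd F u) = snd G (h u)"
  using assms unfolding fsys_iso_def arc_def wf_fsys_def by blast

lemma fsys_iso_refl [simp]: "fsys_iso F F"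
  unfolding fsys_iso_def by (intro exI[of _ id]) auto

lemma fsys_iso_sym: "fsys_iso G F" if "fsys_iso F G"
proof -
  from that obtain h where h: "bij_betw h (fst F) (fst G)"
    "\<And>u v. u \<in> fst F \<Longrightarrow> v \<in> fst F \<Longrightarrow> arc F u v \<longleftrightarrow> arc G (h u) (h v)"
    unfolding fsys_iso_def by blast
  let ?k = "inv_into (fst F) h"
  have "bij_betw ?k (fst G) (fst F)" using h(1) by (rule bij_betw_inv_into)
  moreover have "arc G u v \<longleftrightarrow> arc F (?k u) (?k v)" if "u \<in> fst G" "v \<in> fst G" for u v
    using that h bij_betw_inv_into_right[OF h(1)] bij_betwE[OF bij_betw_inv_into[OF h(1)]]
    by metis
  ultimately show ?thesis unfolding fsys_iso_def by blast
qed

lemma fsys_iso_trans: "fsys_iso F K" if "fsys_iso F G" "fsys_iso G K"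
proof -
  from that(1) obtain h where h: "bij_betw h (fst F) (fst G)"
    "\<And>u v. u \<in> fst F \<Longrightarrow> v \<in> fst F \<Longrightarrow> arc F u v \<longleftrightarrow> arc G (h u) (h v)"
    unfolding fsys_iso_def by blast
  from that(2) obtain k where k: "bij_betw k (fst G) (fst K)"
    "\<And>u v. u \<in> fst G \<Longrightarrow> v \<in> fst G \<Longrightarrow> arc G u v \<longleftrightarrow> arc K (k u) (k v)"
    unfolding fsys_iso_def by blast
  show ?thesis unfolding fsys_iso_def
    using bij_betw_trans[OF h(1) k(1)] h k bij_betwE[OF h(1)]
    by (intro exI[of _ "k \<circ> h"]) auto
qed

lemma wf_fsys_sum: "wf_fsys F \<Longrightarrow> wf_fsys G \<Longrightarrow> wf_fsys (fsys_sum F G)"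
  by (auto simp: wf_fsys_def fsys_sum_def)

lemma wf_fsys_prod: "wf_fsys F \<Longrightarrow> wf_fsys G \<Longrightarrow> wf_fsys (fsys_prod F G)"
  by (auto simp: wf_fsys_def fsys_prod_def)

lemma fsys_iso_sum:
  assumes "fsys_iso F F'" "fsys_iso G G'" "wf_fsys F" "wf_fsys G"
  shows "fsys_iso (fsys_sum F G) (fsys_sum F' G')"
proof -
  obtain h where h: "bij_betw h (fst F) (fst F')" "\<And>u. u \<in> fst F \<Longrightarrow> h (snd F u) = snd F' (h u)"
    using assms fsys_isoE by metis
  obtain k where k: "bij_betw k (fst G) (fst G')" "\<And>u. u \<in> fst G \<Longrightarrow> k (snd G u) = snd G' (k u)"
    using assms fsys_isoE by metis
  show ?thesis
  proof (rule fsys_isoI[where h = "map_sum h k"])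
    have "inj_on (map_sum h k) (fst F <+> fst G)"
      using h(1) k(1) by (auto simp: bij_betw_def intro!: inj_onI dest: inj_onD)
    moreover have "map_sum h k ` (fst F <+> fst G) = h ` fst F <+> k ` fst G"
      unfolding Plus_def image_Un image_image by simp
    ultimately show "bij_betw (map_sum h k) (fst (fsys_sum F G)) (fst (fsys_sum F' G'))"
      using h(1) k(1) by (simp add: bij_betw_def fsys_sum_def)
    fix x assume x: "x \<in> fst (fsys_sum F G)"
    show "snd (fsys_sum F G) x \<in> fst (fsys_sum F G)"
      using x wf_fsys_sum[OF assms(3,4)] by (auto simp: wf_fsys_def)
    show "map_sum h k (snd (fsys_sum F G) x) = snd (fsys_sum F' G') (map_sum h k x)"
      using x h(2) k(2) by (auto simp: fsys_sum_def)
  qed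
qed

lemma fsys_iso_prod:
  assumes "fsys_iso F F'" "fsys_iso G G'" "wf_fsys F" "wf_fsys G"
  shows "fsys_iso (fsys_prod F G) (fsys_prod F' G')"
proof -
  obtain h where h: "bij_betw h (fst F) (fst F')" "\<And>u. u \<in> fst F \<Longrightarrow> h (snd F u) = snd F' (h u)"
    using assms fsys_isoE by metis
  obtain k where k: "bij_betw k (fst G) (fst G')" "\<And>u. u \<in> fst G \<Longrightarrow> k (snd G u) = snd G' (k u)"
    using assms fsys_isoE by metis
  show ?thesis
    by (rule fsys_isoI[where h = "map_prod h k"])
       (use assms h k in \<open>auto simp: fsys_prod_def wf_fsys_def intro: bij_betw_map_prod\<close>)
qed

definition fsys_connected :: "'a fsys \<Rightarrow> bool" where
  "fsys_connected F \<longleftrightarrow> fst F \<noteq> {} \<and> (\<forall>u\<in>fst F. \<forall>v\<in>fst F. equivclp (arc F) u v)"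

definition components :: "'a fsys \<Rightarrow> 'a fsys set" where
  "components F = (\<lambda>u. ({v \<in> fst F. equivclp (arc F) u v}, snd F)) ` fst F"

text \<open>A cycle is given by its set of vertices, so its length is the cardinality of that set.\<close>

definition cycles :: "'a fsys \<Rightarrow> 'a set set" where
  "cycles F = {C. C \<subseteq> fst F \<and> cyclic_on (snd F) C}"

definition dendron :: "'a fsys \<Rightarrow> bool" where
  "dendron F \<longleftrightarrow> fsys_connected F \<and> (\<exists>C. cycles F = {C} \<and> card C = 1)"

definition has_dendron :: "'a fsys \<Rightarrow> bool" where
  "has_dendron F \<longleftrightarrow> (\<exists>K\<in>components F. dendron K)"

lemma equivclp_map:
  assumes "equivclp r u v" "\<And>x y. r x y \<Longrightarrow> s (h x) (h y)"
  shows "equivclp s (h u) (h v)"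
  using assms(1)
proof (induction rule: equivclp_induct)
  case base show ?case by simp
next
  case (step y z)
  then show ?case using assms(2) by (meson equivclp_into_equivclp)
qed

lemma equivclp_in:
  assumes "equivclp (arc F) u v" "wf_fsys F" "u \<in> fst F"
  shows "v \<in> fst F"
  using assms by (induction rule: equivclp_induct) (auto simp: arc_def wf_fsys_def)

lemma fsys_iso_equivclp:
  assumes h: "bij_betw h (fst F) (fst G)" "\<And>u. u \<in> fst F \<Longrightarrow> h (snd F u) = snd G (h u)"
    and wf: "wf_fsys F" and u: "u \<in> fst F" "v \<in> fst F"
  shows "equivclp (arc F) u v \<longleftrightarrow> equivclp (arc G) (h u) (h v)"
proof
  assume "equivclp (arc F) u v"
  then show "equivclp (arc G) (h u) (h v)"
    by (rule equivclp_map) (use h in \<open>auto simp: arc_def dest: bij_betwE\<close>)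
next
  let ?k = "inv_into (fst F) h"
  assume "equivclp (arc G) (h u) (h v)"
  then have "equivclp (arc F) (?k (h u)) (?k (h v))"
  proof (rule equivclp_map)
    fix x y assume "arc G x y"
    then have x: "x \<in> fst G" "y = snd G x" by (auto simp: arc_def)
    then obtain a where a: "a \<in> fst F" "x = h a" using h(1) by (auto simp: bij_betw_def)
    then have "y = h (snd F a)" "snd F a \<in> fst F" using x h wf by (auto simp: wf_fsys_def)
    then show "arc F (?k x) (?k y)" using a h(1) by (simp add: arc_def bij_betw_inv_into_left)
  qed
  then show "equivclp (arc F) u v" using h(1) u by (simp add: bij_betw_inv_into_left)
qed

lemma cycles_iso:
  assumes h: "bij_betw h (fst F) (fst G)" "\<And>u. u \<in> fst F \<Longrightarrow> h (snd F u) = snd G (h u)"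
    and C: "C \<in> cycles F"
  shows "h ` C \<in> cycles G"
proof -
  have "cyclic_on (snd G) (h ` C)"
    by (rule cyclic_on_image[where f = "snd F"]) (use h C in \<open>auto simp: cycles_def\<close>)
  then show ?thesis using C h(1) by (auto simp: cycles_def bij_betw_def)
qed

lemma dendron_iso:
  assumes "fsys_iso F G" "wf_fsys F" "wf_fsys G" "dendron F"
  shows "dendron G"
proof -
  obtain h where h: "bij_betw h (fst F) (fst G)" "\<And>u. u \<in> fst F \<Longrightarrow> h (snd F u) = snd G (h u)"
    using assms fsys_isoE by metis
  obtain k where k: "bij_betw k (fst G) (fst F)" "\<And>u. u \<in> fst G \<Longrightarrow> k (snd G u) = snd F (k u)"
    using assms fsys_isoE fsys_iso_sym by metis
  have F: "fsys_connected F" using assms by (simp add: dendron_def)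
  obtain C where C: "cycles F = {C}" "card C = 1" using assms by (auto simp: dendron_def)
  have CF: "C \<subseteq> fst F" using C(1) unfolding cycles_def by blast
  have eq: "equivclp (arc G) (h u) (h v)" if "u \<in> fst F" "v \<in> fst F" for u v
    using fsys_iso_equivclp[OF h assms(2) that] F that by (simp add: fsys_connected_def)
  have surj: "h ` fst F = fst G" using h(1) by (simp add: bij_betw_def)
  have "fsys_connected G"
    unfolding fsys_connected_def surj[symmetric] using eq F by (auto simp: fsys_connected_def)
  moreover have "cycles G = {h ` C}"
  proof -
    have "h ` C \<in> cycles G" using cycles_iso[OF h] C(1) by simp
    moreover have "D = h ` C" if D: "D \<in> cycles G" for D
    proof -
      have kD: "k ` D = C" and hC: "k ` h ` C = C"
        using cycles_iso[OF k] D \<open>h ` C \<in> cycles G\<close> C(1) by auto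
      have "D \<subseteq> fst G" "h ` C \<subseteq> fst G"
        using D \<open>h ` C \<in> cycles G\<close> unfolding cycles_def by auto
      with kD hC k(1) show ?thesis unfolding bij_betw_def by (metis inj_on_image_eq_iff)
    qed
    ultimately show ?thesis by blast
  qed
  moreover have "card (h ` C) = 1"
    using C(2) CF h(1) by (metis bij_betw_def card_image inj_on_subset)
  ultimately show ?thesis by (auto simp: dendron_def)
qed

lemma wf_component:
  assumes "wf_fsys F" "K \<in> components F"
  shows "wf_fsys K"
proof -
  obtain u where u: "u \<in> fst F" "K = ({v \<in> fst F. equivclp (arc F) u v}, snd F)"
    using assms(2) by (auto simp: components_def)
  have "equivclp (arc F) u (snd F v)" if "equivclp (arc F) u v" "v \<in> fst F" for v
    using that equivclp_into_equivclp[of "arc F" u v "snd F v"] by (simp add: arc_def)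
  then show ?thesis using assms(1) u by (auto simp: wf_fsys_def)
qed

lemma has_dendron_iso:
  assumes "fsys_iso F G" "wf_fsys F" "wf_fsys G" "has_dendron F"
  shows "has_dendron G"
proof -
  obtain h where h: "bij_betw h (fst F) (fst G)" "\<And>u. u \<in> fst F \<Longrightarrow> h (snd F u) = snd G (h u)"
    using assms fsys_isoE by metis
  obtain u where u: "u \<in> fst F" "dendron ({v \<in> fst F. equivclp (arc F) u v}, snd F)"
    using assms(4) by (auto simp: has_dendron_def components_def)
  define K where "K = ({v \<in> fst F. equivclp (arc F) u v}, snd F)"
  define L where "L = ({v \<in> fst G. equivclp (arc G) (h u) v}, snd G)"
  have hu: "h u \<in> fst G" using u(1) h(1) by (auto dest: bij_betwE)
  have KL: "K \<in> components F" "L \<in> components G"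
    using u(1) hu by (auto simp: K_def L_def components_def)
  have wf: "wf_fsys K" "wf_fsys L"
    using KL wf_component assms by blast+
  have img: "h ` fst K = fst L"
  proof
    show "h ` fst K \<subseteq> fst L"
      using fsys_iso_equivclp[OF h assms(2) u(1)] h(1) by (auto simp: K_def L_def dest: bij_betwE)
    show "fst L \<subseteq> h ` fst K"
    proof
      fix w assume w: "w \<in> fst L"
      then obtain v where v: "v \<in> fst F" "w = h v" using h(1) by (auto simp: L_def bij_betw_def)
      then have "v \<in> fst K"
        using w fsys_iso_equivclp[OF h assms(2) u(1) v(1)] by (auto simp: K_def L_def)
      then show "w \<in> h ` fst K" using v by blast
    qed
  qed
  have "fsys_iso K L"
  proof (rule fsys_isoI[where h = h])
    have "fst K \<subseteq> fst F" by (auto simp: K_def)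
    then show "bij_betw h (fst K) (fst L)"
      using img h(1) by (metis bij_betw_def inj_on_subset)
    show "snd K v \<in> fst K" if "v \<in> fst K" for v using that wf(1) by (auto simp: wf_fsys_def)
    show "h (snd K v) = snd L (h v)" if "v \<in> fst K" for v
      using that h(2) by (auto simp: K_def L_def)
  qed
  then have "dendron L" by (rule dendron_iso) (use wf u(2) in \<open>simp_all add: K_def\<close>)
  then show ?thesis using KL by (auto simp: has_dendron_def)
qed

text \<open>Every finite set injects into the natural numbers, so taking representatives on sets of
  naturals loses no isomorphism class; the lemmas on \<^term>\<open>fdds_of\<close> below make this precise.\<close>

definition relabel :: "('a \<Rightarrow> 'b) \<Rightarrow> 'a fsys \<Rightarrow> 'b fsys" where
  "relabel e F = (e ` fst F, \<lambda>n. e (snd F (inv_into (fst F) e n)))"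

lemma wf_relabel: "wf_fsys F \<Longrightarrow> wf_fsys (relabel e F)"
  by (auto simp: wf_fsys_def relabel_def inv_into_into Pi_iff)

lemma relabel_iso:
  assumes "inj_on e (fst F)" "wf_fsys F"
  shows "fsys_iso F (relabel e F)"
  by (rule fsys_isoI[where h = e])
     (use assms in \<open>auto simp: relabel_def wf_fsys_def bij_betw_def\<close>)

definition fsys_rel :: "nat fsys \<Rightarrow> nat fsys \<Rightarrow> bool" where
  "fsys_rel F G \<longleftrightarrow> wf_fsys F \<and> wf_fsys G \<and> fsys_iso F G"

lemma part_equivp_fsys_rel: "part_equivp fsys_rel"
proof (rule part_equivpI)
  have "fsys_rel ({}, id) ({}, id)" by (auto simp: fsys_rel_def wf_fsys_def)
  then show "\<exists>F. fsys_rel F F" by blast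
  show "symp fsys_rel" by (auto simp: symp_def fsys_rel_def intro: fsys_iso_sym)
  show "transp fsys_rel" by (auto simp: transp_def fsys_rel_def intro: fsys_iso_trans)
qed

quotient_type fdds = "nat fsys" / partial: fsys_rel
  by (rule part_equivp_fsys_rel)

lemma fsys_rel_relabelI:
  assumes "fsys_iso F G" "wf_fsys F" "wf_fsys G" "inj_on d (fst F)" "inj_on e (fst G)"
  shows "fsys_rel (relabel d F) (relabel e G)"
proof -
  have "fsys_iso (relabel d F) G"
    using relabel_iso[OF assms(4,2)] assms(1) fsys_iso_sym fsys_iso_trans by blast
  then have "fsys_iso (relabel d F) (relabel e G)"
    using relabel_iso[OF assms(5,3)] fsys_iso_trans by blast
  then show ?thesis using assms by (simp add: fsys_rel_def wf_relabel)
qed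

lift_definition contains_dendron :: "fdds \<Rightarrow> bool" is has_dendron
proof -
  fix F G assume "fsys_rel F G"
  then have "fsys_iso F G" "fsys_iso G F" "wf_fsys F" "wf_fsys G"
    by (simp_all add: fsys_rel_def fsys_iso_sym)
  then show "has_dendron F = has_dendron G" using has_dendron_iso by metis
qed

instantiation fdds :: "{zero, one, plus, times}"
begin

lift_definition zero_fdds :: fdds is "({}, id)"
  by (simp add: fsys_rel_def wf_fsys_def)

lift_definition one_fdds :: fdds is "({0}, id)"
  by (simp add: fsys_rel_def wf_fsys_def)

lift_definition plus_fdds :: "fdds \<Rightarrow> fdds \<Rightarrow> fdds" is
  "\<lambda>F G. relabel sum_encode (fsys_sum F G)"
  by (rule fsys_rel_relabelI)
     (simp_all add: fsys_rel_def fsys_iso_sum wf_fsys_sum inj_sum_encode)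

lift_definition times_fdds :: "fdds \<Rightarrow> fdds \<Rightarrow> fdds" is
  "\<lambda>F G. relabel prod_encode (fsys_prod F G)"
  by (rule fsys_rel_relabelI)
     (simp_all add: fsys_rel_def fsys_iso_prod wf_fsys_prod inj_prod_encode)

instance ..

end

definition fdds_of :: "'a fsys \<Rightarrow> fdds" where
  "fdds_of F = abs_fdds (relabel (SOME e. inj_on e (fst F)) F)"

lemma fdds_of_inj:
  assumes "wf_fsys F"
  shows "inj_on (SOME e::'a \<Rightarrow> nat. inj_on e (fst F)) (fst (F :: 'a fsys))"
proof -
  have "\<exists>e::'a \<Rightarrow> nat. inj_on e (fst F)"
    using assms finite_imp_inj_to_nat_seg unfolding wf_fsys_def by metis
  then show ?thesis by (rule someI_ex)
qed

lemma fdds_of_eq_iff: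
  assumes "wf_fsys F" "wf_fsys G"
  shows "fdds_of F = fdds_of G \<longleftrightarrow> fsys_iso F G"
proof -
  let ?F = "relabel (SOME e. inj_on e (fst F)) F :: nat fsys"
    and ?G = "relabel (SOME e. inj_on e (fst G)) G :: nat fsys"
  have iso: "fsys_iso F ?F" "fsys_iso G ?G" and wf: "wf_fsys ?F" "wf_fsys ?G"
    using assms by (simp_all add: relabel_iso fdds_of_inj wf_relabel)
  have "fdds_of F = fdds_of G \<longleftrightarrow> fsys_rel ?F ?G"
    unfolding fdds_of_def
    using Quotient_rel[OF Quotient_fdds, of ?F ?G] wf by (auto simp: fsys_rel_def)
  also have "\<dots> \<longleftrightarrow> fsys_iso F G"
  proof
    assume "fsys_rel ?F ?G"
    then have "fsys_iso F ?G" by (intro fsys_iso_trans[OF iso(1)]) (simp add: fsys_rel_def)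
    then show "fsys_iso F G" using fsys_iso_sym[OF iso(2)] by (rule fsys_iso_trans)
  next
    assume "fsys_iso F G"
    then show "fsys_rel ?F ?G"
      by (rule fsys_rel_relabelI) (simp_all add: assms fdds_of_inj)
  qed
  finally show ?thesis .
qed

lemma fdds_of_abs: "wf_fsys F \<Longrightarrow> fdds_of F = abs_fdds F"
  unfolding fdds_of_def
  by (rule Quotient_rel_abs[OF Quotient_fdds])
     (simp add: fsys_rel_def wf_relabel fsys_iso_sym relabel_iso fdds_of_inj)

lemma fdds_of_abs_iso:
  assumes "fsys_iso F G" "wf_fsys F" "wf_fsys G"
  shows "fdds_of F = abs_fdds G"
  using fdds_of_eq_iff[OF assms(2,3)] fdds_of_abs[OF assms(3)] assms(1) by simp

lemma fdds_of_cases: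
  obtains F :: "nat fsys" where "wf_fsys F" "X = fdds_of F"
proof -
  have "fsys_rel (rep_fdds X) (rep_fdds X)" "abs_fdds (rep_fdds X) = X"
    using Quotient_rep_reflp[OF Quotient_fdds] Quotient_abs_rep[OF Quotient_fdds] by auto
  then show ?thesis using that[of "rep_fdds X"] fdds_of_abs by (metis fsys_rel_def)
qed

lemma fdds_of_relabel:
  assumes "wf_fsys F" "inj_on e (fst F)"
  shows "abs_fdds (relabel e F) = fdds_of F"
  using fdds_of_abs_iso[OF relabel_iso[OF assms(2,1)]] assms by (simp add: wf_relabel)

lemma zero_fdds_of: "0 = fdds_of ({}, f)"
  unfolding zero_fdds.abs_eq
  by (rule sym, rule fdds_of_abs_iso) (auto simp: wf_fsys_def bij_betw_def intro!: fsys_isoI[where h = "\<lambda>_. 0"])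

lemma one_fdds_of: "1 = fdds_of ({x}, \<lambda>_. x)"
  unfolding one_fdds.abs_eq
  by (rule sym, rule fdds_of_abs_iso)
     (auto simp: wf_fsys_def intro!: fsys_isoI[where h = "\<lambda>_. 0"])

lemma plus_fdds_of:
  assumes "wf_fsys F" "wf_fsys G"
  shows "fdds_of F + fdds_of G = fdds_of (fsys_sum F G)"
proof -
  obtain F' G' :: "nat fsys" where wf: "wf_fsys F'" "wf_fsys G'"
    and eq: "fdds_of F = fdds_of F'" "fdds_of G = fdds_of G'"
    using fdds_of_cases by metis
  have "fdds_of F + fdds_of G = abs_fdds (relabel sum_encode (fsys_sum F' G'))"
    unfolding eq using wf by (simp add: fdds_of_abs plus_fdds.abs_eq eq_onp_def fsys_rel_def)
  also have "\<dots> = fdds_of (fsys_sum F' G')"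
    by (intro fdds_of_relabel wf_fsys_sum wf inj_sum_encode)
  also have "\<dots> = fdds_of (fsys_sum F G)"
    using eq assms wf by (simp add: fdds_of_eq_iff wf_fsys_sum fsys_iso_sum fsys_iso_sym)
  finally show ?thesis .
qed

lemma times_fdds_of:
  assumes "wf_fsys F" "wf_fsys G"
  shows "fdds_of F * fdds_of G = fdds_of (fsys_prod F G)"
proof -
  obtain F' G' :: "nat fsys" where wf: "wf_fsys F'" "wf_fsys G'"
    and eq: "fdds_of F = fdds_of F'" "fdds_of G = fdds_of G'"
    using fdds_of_cases by metis
  have "fdds_of F * fdds_of G = abs_fdds (relabel prod_encode (fsys_prod F' G'))"
    unfolding eq using wf by (simp add: fdds_of_abs times_fdds.abs_eq eq_onp_def fsys_rel_def)
  also have "\<dots> = fdds_of (fsys_prod F' G')"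
    by (intro fdds_of_relabel wf_fsys_prod wf inj_prod_encode)
  also have "\<dots> = fdds_of (fsys_prod F G)"
    using eq assms wf by (simp add: fdds_of_eq_iff wf_fsys_prod fsys_iso_prod fsys_iso_sym)
  finally show ?thesis .
qed

lemma contains_dendron_of:
  assumes "wf_fsys F"
  shows "contains_dendron (fdds_of F) \<longleftrightarrow> has_dendron F"
proof -
  obtain F' :: "nat fsys" where wf: "wf_fsys F'" and eq: "fdds_of F = fdds_of F'"
    using fdds_of_cases by metis
  have "contains_dendron (fdds_of F) \<longleftrightarrow> has_dendron F'"
    unfolding eq using wf
    by (simp add: fdds_of_abs contains_dendron.abs_eq eq_onp_def fsys_rel_def)
  also have "\<dots> \<longleftrightarrow> has_dendron F"
    using eq assms wf has_dendron_iso fsys_iso_sym by (metis fdds_of_eq_iff)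
  finally show ?thesis .
qed

lemma fdds_of_eqI:
  assumes "wf_fsys F" "wf_fsys G"
    "\<And>u. u \<in> fst F \<Longrightarrow> h u \<in> fst G \<and> k (h u) = u"
    "\<And>w. w \<in> fst G \<Longrightarrow> k w \<in> fst F \<and> h (k w) = w"
    "\<And>u. u \<in> fst F \<Longrightarrow> h (snd F u) = snd G (h u)"
  shows "fdds_of F = fdds_of G"
proof -
  have "bij_betw h (fst F) (fst G)"
    by (rule bij_betw_byWitness[where f' = k]) (use assms(3,4) in auto)
  then show ?thesis
    using assms fsys_isoI[of h F G] by (auto simp: fdds_of_eq_iff wf_fsys_def)
qed

instance fdds :: comm_semiring_1
proof
  fix X Y Z :: fdds
  obtain F G K :: "nat fsys" where wf: "wf_fsys F" "wf_fsys G" "wf_fsys K"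
    and X: "X = fdds_of F" and Y: "Y = fdds_of G" and Z: "Z = fdds_of K"
    using fdds_of_cases by metis
  have wf0: "wf_fsys ({} :: nat set, id)" and wf1: "wf_fsys ({0 :: nat}, \<lambda>_. 0)"
    by (auto simp: wf_fsys_def)
  have zero: "0 = fdds_of ({} :: nat set, id)" and one: "1 = fdds_of ({0 :: nat}, \<lambda>_. 0)"
    by (simp_all only: zero_fdds_of[symmetric] one_fdds_of[symmetric])
  note wfs = wf wf0 wf1 wf_fsys_sum wf_fsys_prod
  note ops = plus_fdds_of times_fdds_of wfs
  show "X + Y + Z = X + (Y + Z)" unfolding X Y Z
    by (simp add: ops, rule fdds_of_eqI[where h = "case_sum (map_sum id Inl) (Inr \<circ> Inr)"
        and k = "case_sum (Inl \<circ> Inl) (map_sum Inr id)"],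
        simp add: wfs, simp add: wfs)
       (auto simp: fsys_sum_def fsys_prod_def)
  show "X + Y = Y + X" unfolding X Y
    by (simp add: ops, rule fdds_of_eqI[where h = "case_sum Inr Inl"
        and k = "case_sum Inr Inl"],
        simp add: wfs, simp add: wfs)
       (auto simp: fsys_sum_def fsys_prod_def)
  show "0 + X = X" unfolding X zero
    by (simp add: ops, rule fdds_of_eqI[where h = "case_sum id id"
        and k = "Inr"],
        simp add: wfs, simp add: wfs)
       (auto simp: fsys_sum_def fsys_prod_def)
  show "X * Y * Z = X * (Y * Z)" unfolding X Y Z
    by (simp add: ops, rule fdds_of_eqI[where h = "\<lambda>((a, b), c). (a, (b, c))"
        and k = "\<lambda>(a, (b, c)). ((a, b), c)"],
        simp add: wfs, simp add: wfs)
       (auto simp: fsys_sum_def fsys_prod_def)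
  show "X * Y = Y * X" unfolding X Y
    by (simp add: ops, rule fdds_of_eqI[where h = prod.swap
        and k = "prod.swap"],
        simp add: wfs, simp add: wfs)
       (auto simp: fsys_sum_def fsys_prod_def)
  show "1 * X = X" unfolding X one
    by (simp add: ops, rule fdds_of_eqI[where h = snd
        and k = "\<lambda>x. (0, x)"],
        simp add: wfs, simp add: wfs)
       (auto simp: fsys_sum_def fsys_prod_def)
  show "(X + Y) * Z = X * Z + Y * Z" unfolding X Y Z
    by (simp add: ops, rule fdds_of_eqI[where h = "\<lambda>(s, c). map_sum (\<lambda>a. (a, c)) (\<lambda>b. (b, c)) s"
        and k = "case_sum (\<lambda>(a, c). (Inl a, c)) (\<lambda>(b, c). (Inr b, c))"],
        simp add: wfs, simp add: wfs)
       (auto simp: fsys_sum_def fsys_prod_def)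
  show "0 * X = 0" unfolding X zero
    by (simp add: ops, rule fdds_of_eqI[where h = fst
        and k = "\<lambda>x. (x, undefined)"],
        simp add: wfs, simp add: wfs)
       (auto simp: fsys_sum_def fsys_prod_def)
  show "X * 0 = 0" unfolding X zero
    by (simp add: ops, rule fdds_of_eqI[where h = snd
        and k = "\<lambda>x. (undefined, x)"],
        simp add: wfs, simp add: wfs)
       (auto simp: fsys_sum_def fsys_prod_def)
  show "(0 :: fdds) \<noteq> 1"
    unfolding zero one by (auto simp: fdds_of_eq_iff wf0 wf1 fsys_iso_def bij_betw_def)
qed

end

theory Submission
  imports Defs "HOL-Number_Theory.Cong"
begin

text \<open>Write \<open>C\<^sub>q\<close> for the cycle of length \<open>q\<close>. A system \<open>A\<close> all of whose vertices end up in cycles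
  of length \<open>q\<close> maps homomorphically onto a disjoint union of copies of \<open>C\<^sub>q\<close>, hence
  \<open>A * C\<^sub>q = q * A\<close>. So \<open>A\<close> cannot distinguish \<open>C\<^sub>q\<close> from \<open>q\<close>, and it is annihilated by the formal
  difference \<open>q - C\<^sub>q\<close>. Multiplying these differences over \<open>2 \<le> q \<le> M\<close> and collecting positive and
  negative terms yields \<open>X\<close> and \<open>Y\<close> with \<open>A * X = A * Y\<close> for every \<open>A\<close> whose cycle lengths lie in
  \<open>{2..M}\<close>, that is, for every dendron-free \<open>A\<close> if \<open>M\<close> is large. Then also \<open>A * X\<^sup>i = A * Y\<^sup>i\<close> for
  \<open>i \<ge> 1\<close>. Finally \<open>X \<noteq> Y\<close>, because \<open>X\<close> has a fixed point and \<open>Y\<close> has none.\<close>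

lemma funpow_in: "f \<in> V \<rightarrow> V \<Longrightarrow> u \<in> V \<Longrightarrow> (f ^^ k) u \<in> V"
  by (induction k) auto

subsection \<open>Dendrons and fixed points\<close>

text \<open>Reaching \<open>w\<close> passes across arcs in both directions: an arc into
  \<open>y\<close> adds one iteration, an arc out of \<open>y\<close> is absorbed because
  \<open>w\<close> is fixed.\<close>

lemma equivclp_fixed_point:
  assumes "equivclp (arc F) w v" "snd F w = w"
  shows "\<exists>k. (snd F ^^ k) v = w"
  using assms(1)
proof (induction rule: equivclp_induct)
  case base
  show ?case by (intro exI[of _ 0]) simp
next
  case (step y z)
  obtain k where k: "(snd F ^^ k) y = w" using step by blast
  from step(2) show ?case
  proof
    assume "arc F y z"
    then have "(snd F ^^ k) z = snd F ((snd F ^^ k) y)" by (simp add: arc_def funpow_swap1)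
    then show ?thesis using k assms(2) by auto
  next
    assume "arc F z y"
    then have "(snd F ^^ Suc k) z = w" using k by (simp add: arc_def funpow_swap1)
    then show ?thesis by blast
  qed
qed

lemma equivclp_funpow:
  assumes "wf_fsys F" "v \<in> fst F"
  shows "equivclp (arc F) v ((snd F ^^ k) v)"
proof (induction k)
  case (Suc k)
  have "arc F ((snd F ^^ k) v) ((snd F ^^ Suc k) v)"
    using assms funpow_in[of "snd F" "fst F" v k] by (simp add: arc_def wf_fsys_def)
  with Suc show ?case by (meson equivclp_into_equivclp)
qed simp

text \<open>Every vertex of the component runs into \<open>w\<close>. This links any two of them
  through \<open>w\<close> and forces every cycle to contain \<open>w\<close>, hence to be
  \<open>{w}\<close>.\<close>

lemma dendron_component:
  assumes wf: "wf_fsys F" and w: "w \<in> fst F" "snd F w = w"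
  shows "dendron ({v \<in> fst F. equivclp (arc F) w v}, snd F)" (is "dendron ?K")
proof -
  have K: "?K \<in> components F" using w by (auto simp: components_def)
  have wfK: "wf_fsys ?K" by (rule wf_component[OF wf K])
  have reach: "equivclp (arc ?K) v w" if v: "v \<in> fst ?K" for v
  proof -
    obtain k where "(snd F ^^ k) v = w" using equivclp_fixed_point[of F w v] v w by auto
    then show ?thesis using equivclp_funpow[OF wfK v, of k] by simp
  qed
  have "w \<in> fst ?K" using w by simp
  moreover have "equivclp (arc ?K) u v" if "u \<in> fst ?K" "v \<in> fst ?K" for u v
    using reach[OF that(1)] reach[OF that(2)] by (meson equivclp_sym equivclp_trans)
  ultimately have conn: "fsys_connected ?K" unfolding fsys_connected_def by blast
  have orb: "orbit (snd F) w = {w}"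
  proof
    show "orbit (snd F) w \<subseteq> {w}"
    proof
      fix x assume "x \<in> orbit (snd F) w"
      then show "x \<in> {w}" by (induction) (use w in auto)
    qed
    show "{w} \<subseteq> orbit (snd F) w" using orbit.base[of "snd F" w] w by simp
  qed
  have "cycles ?K = {{w}}"
  proof
    have "cyclic_on (snd F) {w}" using orb by (auto simp: cyclic_on_def)
    then show "{{w}} \<subseteq> cycles ?K" using w by (simp add: cycles_def)
    show "cycles ?K \<subseteq> {{w}}"
    proof
      fix C assume "C \<in> cycles ?K"
      then have C: "C \<subseteq> fst ?K" "cyclic_on (snd F) C" by (auto simp: cycles_def)
      then obtain x where x: "x \<in> C" "C = orbit (snd F) x" by (auto simp: cyclic_on_def)
      obtain k where k: "(snd F ^^ k) x = w"
        using equivclp_fixed_point[of F w x] C(1) x(1) w by auto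
      have "w \<in> C" using cyclic_on_funpow_in[OF C(2) x(1), of k] k by simp
      then have "C = orbit (snd F) w" by (rule orbit_cyclic_eq3[OF C(2), symmetric])
      then show "C \<in> {{w}}" using orb by simp
    qed
  qed
  then show ?thesis using conn by (auto simp: dendron_def)
qed

text \<open>Replaces dendrons by fixed points, which can be read off directly from sums and
  products.\<close>

lemma contains_dendron_fdds_of:
  assumes "wf_fsys F"
  shows "contains_dendron (fdds_of F) \<longleftrightarrow> (\<exists>u\<in>fst F. snd F u = u)"
proof -
  have "has_dendron F \<longleftrightarrow> (\<exists>u\<in>fst F. snd F u = u)"
  proof
    assume "\<exists>u\<in>fst F. snd F u = u"
    then show "has_dendron F"
      using dendron_component[OF assms] by (auto simp: has_dendron_def components_def)
  next
    assume "has_dendron F"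
    then obtain K where K: "K \<in> components F" "dendron K" by (auto simp: has_dendron_def)
    then obtain C where C: "C \<in> cycles K" "card C = 1" by (auto simp: dendron_def)
    then obtain x where x: "C = {x}" by (auto simp: card_1_singleton_iff)
    have "x \<in> fst F" "cyclic_on (snd F) {x}"
      using C(1) K(1) x by (auto simp: cycles_def components_def)
    moreover from this(2) have "snd F x = x" using cyclic_on_inI[of "snd F" "{x}" x] by simp
    ultimately show "\<exists>u\<in>fst F. snd F u = u" by blast
  qed
  then show ?thesis using contains_dendron_of[OF assms] by simp
qed

lemma contains_dendron_zero [simp]: "\<not> contains_dendron 0"
  using contains_dendron_fdds_of[of "({} :: nat set, id)"]
  by (simp add: wf_fsys_def flip: zero_fdds_of)

lemma contains_dendron_one [simp]: "contains_dendron 1"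
  using contains_dendron_fdds_of[of "({0 :: nat}, \<lambda>_. 0)"]
  by (simp add: wf_fsys_def flip: one_fdds_of)

lemma contains_dendron_plus [simp]:
  "contains_dendron (X + Y) \<longleftrightarrow> contains_dendron X \<or> contains_dendron Y"
proof -
  obtain F G :: "nat fsys" where wf: "wf_fsys F" "wf_fsys G" and XY: "X = fdds_of F" "Y = fdds_of G"
    using fdds_of_cases by metis
  have "(\<exists>u\<in>fst (fsys_sum F G). snd (fsys_sum F G) u = u) \<longleftrightarrow>
      (\<exists>u\<in>fst F. snd F u = u) \<or> (\<exists>u\<in>fst G. snd G u = u)"
    by (auto simp: fsys_sum_def Plus_def bex_Un)
  then show ?thesis
    by (simp add: XY wf plus_fdds_of contains_dendron_fdds_of wf_fsys_sum)
qed

lemma contains_dendron_times [simp]: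
  "contains_dendron (X * Y) \<longleftrightarrow> contains_dendron X \<and> contains_dendron Y"
proof -
  obtain F G :: "nat fsys" where wf: "wf_fsys F" "wf_fsys G" and XY: "X = fdds_of F" "Y = fdds_of G"
    using fdds_of_cases by metis
  have "(\<exists>u\<in>fst (fsys_prod F G). snd (fsys_prod F G) u = u) \<longleftrightarrow>
      (\<exists>u\<in>fst F. snd F u = u) \<and> (\<exists>u\<in>fst G. snd G u = u)"
    by (auto simp: fsys_prod_def)
  then show ?thesis
    by (simp add: XY wf times_fdds_of contains_dendron_fdds_of wf_fsys_prod)
qed

lemma contains_dendron_of_nat [simp]: "contains_dendron (of_nat n) \<longleftrightarrow> n \<noteq> 0"
  by (induction n) auto

subsection \<open>Eventual periods\<close>

definition periodic_eventually :: "('a \<Rightarrow> 'a) \<Rightarrow> 'a \<Rightarrow> nat \<Rightarrow> bool" where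
  "periodic_eventually f u p \<longleftrightarrow> (\<exists>k. (f ^^ (k + p)) u = (f ^^ k) u)"

text \<open>The length of the cycle that \<open>u\<close> finally enters, when its orbit is
  finite.\<close>

definition eventual_period :: "('a \<Rightarrow> 'a) \<Rightarrow> 'a \<Rightarrow> nat" where
  "eventual_period f u = (LEAST p. 0 < p \<and> periodic_eventually f u p)"

lemma funpow_eq_mono:
  fixes f :: "'a \<Rightarrow> 'a"
  assumes "(f ^^ i) u = (f ^^ j) v"
  shows "(f ^^ (m + i)) u = (f ^^ (m + j)) v"
  using arg_cong[where f = "f ^^ m", OF assms] by (simp add: funpow_add)

text \<open>From iterate \<open>k + l\<close> on both shifts act trivially, so the iterates
  \<open>k + l + p\<close> and \<open>k + l + q\<close> agree.\<close>

lemma periodic_eventually_diff: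
  assumes "periodic_eventually f u p" "periodic_eventually f u q" "p \<le> q"
  shows "periodic_eventually f u (q - p)"
proof -
  obtain k l where k: "(f ^^ (k + p)) u = (f ^^ k) u" and l: "(f ^^ (l + q)) u = (f ^^ l) u"
    using assms by (auto simp: periodic_eventually_def)
  have "(f ^^ (k + l + p + (q - p))) u = (f ^^ (k + (l + q))) u" using assms(3) by (simp add: ac_simps)
  also have "\<dots> = (f ^^ (k + l)) u" using l by (rule funpow_eq_mono)
  also have "\<dots> = (f ^^ (l + k)) u" by (simp add: ac_simps)
  also have "\<dots> = (f ^^ (l + (k + p))) u" using k by (rule funpow_eq_mono[symmetric])
  finally show ?thesis unfolding periodic_eventually_def
    by (intro exI[of _ "k + l + p"]) (simp add: ac_simps)
qed

lemma periodic_eventually_mod: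
  assumes "periodic_eventually f u p" "periodic_eventually f u q"
  shows "periodic_eventually f u (q mod p)"
  using assms(2)
proof (induction q rule: less_induct)
  case (less q)
  show ?case
  proof (cases "p \<le> q \<and> 0 < p")
    case True
    then have "periodic_eventually f u ((q - p) mod p)"
      using less periodic_eventually_diff[OF assms(1) less(2)] by simp
    then show ?thesis using True by (simp add: le_mod_geq)
  qed (use less in auto)
qed

lemma eventual_period_dvd:
  assumes "periodic_eventually f u q"
  shows "eventual_period f u dvd q"
proof (cases "q = 0")
  case False
  let ?p = "eventual_period f u"
  have p: "0 < ?p \<and> periodic_eventually f u ?p"
    unfolding eventual_period_def by (rule LeastI[of _ q]) (use False assms in simp)
  have "periodic_eventually f u (q mod ?p)"
    by (rule periodic_eventually_mod[OF conjunct2[OF p] assms])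
  moreover have "q mod ?p < ?p" using p by simp
  then have "\<not> (0 < q mod ?p \<and> periodic_eventually f u (q mod ?p))"
    unfolding eventual_period_def by (rule not_less_Least)
  ultimately show ?thesis by (simp add: dvd_eq_mod_eq_0)
qed simp

text \<open>A coincidence of two iterates makes the difference of their exponents an eventual
  period. This is why a phase does not depend on the chosen exponents.\<close>

lemma eventual_period_cong:
  assumes "(f ^^ i) u = (f ^^ j) u"
  shows "[i = j] (mod eventual_period f u)"
proof -
  have *: "[i = j] (mod eventual_period f u)" if "(f ^^ i) u = (f ^^ j) u" "i \<le> j" for i j
  proof -
    have "periodic_eventually f u (j - i)"
      using that unfolding periodic_eventually_def by (intro exI[of _ i]) simp
    then have "eventual_period f u dvd j - i" by (rule eventual_period_dvd)
    then show ?thesis using that(2) by (simp add: cong_sym cong_altdef_nat)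
  qed
  show ?thesis using *[of i j] *[of j i] assms by (metis cong_sym nle_le)
qed

lemma eventual_period_step: "eventual_period f (f u) = eventual_period f u"
proof -
  have "periodic_eventually f (f u) p \<longleftrightarrow> periodic_eventually f u p" for p
  proof
    assume "periodic_eventually f (f u) p"
    then obtain k where "(f ^^ (k + p)) (f u) = (f ^^ k) (f u)"
      by (auto simp: periodic_eventually_def)
    then have "(f ^^ (Suc k + p)) u = (f ^^ Suc k) u" by (simp add: funpow_swap1)
    then show "periodic_eventually f u p" unfolding periodic_eventually_def by blast
  next
    assume "periodic_eventually f u p"
    then obtain k where "(f ^^ (k + p)) u = (f ^^ k) u"
      by (auto simp: periodic_eventually_def)
    then have "(f ^^ (k + p)) (f u) = (f ^^ k) (f u)" by (simp flip: funpow_swap1)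
    then show "periodic_eventually f (f u) p" unfolding periodic_eventually_def by blast
  qed
  then show ?thesis by (simp add: eventual_period_def)
qed

lemma eventual_period:
  assumes "finite V" "f \<in> V \<rightarrow> V" "u \<in> V"
  shows "0 < eventual_period f u" "periodic_eventually f u (eventual_period f u)"
proof -
  have "(\<lambda>k. (f ^^ k) u) ` UNIV \<subseteq> V" using funpow_in[OF assms(2,3)] by auto
  then have "finite ((\<lambda>k. (f ^^ k) u) ` UNIV)" using assms(1) by (rule finite_subset)
  then have "\<not> inj (\<lambda>k. (f ^^ k) u)" using finite_imageD infinite_UNIV_nat by blast
  then obtain i j where ij: "(f ^^ i) u = (f ^^ j) u" "i < j"
    by (metis (mono_tags, lifting) injI linorder_neqE_nat)
  then have "0 < j - i \<and> periodic_eventually f u (j - i)"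
    unfolding periodic_eventually_def by (auto intro!: exI[of _ i])
  then have "0 < eventual_period f u \<and> periodic_eventually f u (eventual_period f u)"
    unfolding eventual_period_def by (rule LeastI)
  then show "0 < eventual_period f u" "periodic_eventually f u (eventual_period f u)" by auto
qed

text \<open>For vertices of a system this means lying in the same component, in a form that supplies
  the exponents from which phases are computed.\<close>

definition meets :: "('a \<Rightarrow> 'a) \<Rightarrow> 'a \<Rightarrow> 'a \<Rightarrow> bool" where
  "meets f u v \<longleftrightarrow> (\<exists>i j. (f ^^ i) u = (f ^^ j) v)"

lemma meets_step: "meets f (f u) v \<longleftrightarrow> meets f u v"
proof
  assume "meets f (f u) v"
  then obtain i j where "(f ^^ i) (f u) = (f ^^ j) v" by (auto simp: meets_def)
  then have "(f ^^ Suc i) u = (f ^^ j) v" by (simp add: funpow_swap1)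
  then show "meets f u v" unfolding meets_def by blast
next
  assume "meets f u v"
  then obtain i j where "(f ^^ i) u = (f ^^ j) v" by (auto simp: meets_def)
  then have "(f ^^ i) (f u) = (f ^^ Suc j) v" by (simp flip: funpow_swap1)
  then show "meets f (f u) v" unfolding meets_def by blast
qed

text \<open>The phase of \<open>u\<close> is \<open>j - i\<close> modulo \<open>p\<close> where \<open>f\<^sup>i u = f\<^sup>j r\<close> and \<open>r\<close> is a base vertex chosen
  in the component of \<open>u\<close>.\<close>

lemma phase_exists:
  assumes V: "f \<in> V \<rightarrow> V" and per: "\<And>u. u \<in> V \<Longrightarrow> eventual_period f u = p"
  shows "\<exists>g :: 'a \<Rightarrow> int. \<forall>u\<in>V. [g (f u) = g u + 1] (mod int p)"
proof -
  define r where "r u = (SOME v. v \<in> V \<and> meets f u v)" for u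
  have r: "r u \<in> V" "meets f u (r u)" if "u \<in> V" for u
  proof -
    have "u \<in> V \<and> meets f u u" using that by (auto simp: meets_def)
    then have "r u \<in> V \<and> meets f u (r u)" unfolding r_def by (rule someI)
    then show "r u \<in> V" "meets f u (r u)" by auto
  qed
  \<comment> \<open>\<open>u\<close> and \<open>f u\<close> meet the same vertices, so the choice
    operator gets the same predicate and returns the same base vertex.\<close>
  have r_step: "r (f u) = r u" for u by (simp add: r_def meets_step)
  have "\<forall>u\<in>V. \<exists>z. \<exists>i j. (f ^^ i) u = (f ^^ j) (r u) \<and> z = int j - int i"
    using r(2) by (auto simp: meets_def)
  then have "\<exists>g. \<forall>u\<in>V. \<exists>i j. (f ^^ i) u = (f ^^ j) (r u) \<and> g u = int j - int i" by (rule bchoice)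
  then obtain g where g: "\<And>u. u \<in> V \<Longrightarrow> \<exists>i j. (f ^^ i) u = (f ^^ j) (r u) \<and> g u = int j - int i"
    by blast
  show ?thesis
  proof (intro exI ballI)
    fix u assume u: "u \<in> V"
    then have fu: "f u \<in> V" using V by auto
    obtain i j where ij: "(f ^^ i) u = (f ^^ j) (r u)" "g u = int j - int i" using g u by blast
    obtain k l where kl: "(f ^^ k) (f u) = (f ^^ l) (r u)" "g (f u) = int l - int k"
      using g[OF fu] r_step by auto
    have kl': "(f ^^ Suc k) u = (f ^^ l) (r u)" using kl(1) by (simp add: funpow_swap1)
    \<comment> \<open>The relations for \<open>u\<close> and \<open>f u\<close> combine into a
      coincidence on the orbit of \<open>r u\<close>, whose period is \<open>p\<close>, so the
      exponents can be compared modulo \<open>p\<close>.\<close>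
    have "(f ^^ (Suc k + j)) (r u) = (f ^^ (Suc k + i)) u" by (rule funpow_eq_mono[OF ij(1)[symmetric]])
    also have "\<dots> = (f ^^ (i + Suc k)) u" by (simp only: add.commute)
    also have "\<dots> = (f ^^ (i + l)) (r u)" using kl' by (rule funpow_eq_mono)
    finally have "[Suc k + j = i + l] (mod p)"
      using eventual_period_cong[of "Suc k + j" f "r u" "i + l"] per[OF r(1)[OF u]] by simp
    then have "[int (Suc k + j) = int (i + l)] (mod int p)" by (simp only: cong_int_iff)
    then have "[int (Suc k + j) + (- int i - int k) = int (i + l) + (- int i - int k)] (mod int p)"
      by (rule cong_add) simp
    then have "[int j - int i + 1 = int l - int k] (mod int p)" by (simp add: algebra_simps)
    then show "[g (f u) = g u + 1] (mod int p)" unfolding ij(2) kl(2) by (rule cong_sym)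
  qed
qed

subsection \<open>Cycles\<close>

definition cycle_fdds :: "nat \<Rightarrow> fdds" where
  "cycle_fdds q = fdds_of ({..<q}, \<lambda>i. Suc i mod q)"

lemma wf_cycle: "wf_fsys ({..<q}, \<lambda>i. Suc i mod q)"
  by (auto simp: wf_fsys_def)

lemma contains_dendron_cycle:
  assumes "2 \<le> q"
  shows "\<not> contains_dendron (cycle_fdds q)"
proof -
  have "Suc i mod q \<noteq> i" if "i < q" for i
    using that assms by (cases "Suc i = q") auto
  then show ?thesis
    using contains_dendron_fdds_of[OF wf_cycle, of q] by (auto simp: cycle_fdds_def)
qed

lemma of_nat_fdds_of: "of_nat n = fdds_of ({..<n}, id)"
proof (induction n)
  case 0
  then show ?case by (simp flip: zero_fdds_of)
next
  case (Suc n)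
  have wf: "wf_fsys ({..<n}, id)" "wf_fsys ({n}, \<lambda>_. n)" for n :: nat by (auto simp: wf_fsys_def)
  have "of_nat (Suc n) = fdds_of ({..<n}, id) + fdds_of ({n}, \<lambda>_. n)"
    by (simp only: of_nat_Suc Suc.IH one_fdds_of[of n] add.commute)
  also have "\<dots> = fdds_of (fsys_sum ({..<n}, id) ({n}, \<lambda>_. n))" by (simp add: plus_fdds_of wf)
  also have "\<dots> = fdds_of ({..<Suc n}, id)"
    by (rule fdds_of_eqI[where h = "case_sum id id" and k = "\<lambda>i. if i < n then Inl i else Inr i"])
       (use wf wf_fsys_sum[OF wf] in \<open>auto simp: fsys_sum_def\<close>)
  finally show ?case .
qed

text \<open>Along an arc the position on the cycle and the phase \<open>g\<close> both grow by 1
  modulo \<open>q\<close>, so their difference stays constant. Replacing the position by this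
  difference turns the cycle factor into \<open>q\<close> fixed points.\<close>

lemma times_cycle_fdds:
  assumes wf: "wf_fsys F" and q: "0 < q"
    and per: "\<And>u. u \<in> fst F \<Longrightarrow> eventual_period (snd F) u = q"
  shows "fdds_of F * cycle_fdds q = of_nat q * fdds_of F"
proof -
  obtain g where g: "\<And>u. u \<in> fst F \<Longrightarrow> [g (snd F u) = g u + 1] (mod int q)"
    using phase_exists[of "snd F" "fst F" q] wf per unfolding wf_fsys_def by auto
  define h where "h = (\<lambda>(u, i). (u, nat ((int i - g u) mod int q)))"
  define k where "k = (\<lambda>(u, i). (u, nat ((int i + g u) mod int q)))"
  have wfI: "wf_fsys ({..<q}, id)" by (auto simp: wf_fsys_def)
  have "fdds_of F * cycle_fdds q = fdds_of (fsys_prod F ({..<q}, \<lambda>i. Suc i mod q))"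
    by (simp add: cycle_fdds_def times_fdds_of wf wf_cycle)
  also have "\<dots> = fdds_of (fsys_prod F ({..<q}, id))"
  proof (rule fdds_of_eqI[where h = h and k = k])
    fix x assume x: "x \<in> fst (fsys_prod F ({..<q}, \<lambda>i. Suc i mod q))"
    then obtain u i where ui: "x = (u, i)" "u \<in> fst F" "i < q" by (auto simp: fsys_prod_def)
    show "h x \<in> fst (fsys_prod F ({..<q}, id)) \<and> k (h x) = x"
      using ui q by (auto simp: fsys_prod_def h_def k_def nat_less_iff mod_simps)
    have "[int i + 1 - g (snd F u) = int i + 1 - (g u + 1)] (mod int q)"
      using g[OF ui(2)] by (intro cong_diff cong_refl)
    then have "(int i + 1 - g (snd F u)) mod int q = (int i - g u) mod int q"
      by (simp add: cong_def)
    moreover have "(int (Suc i mod q) - z) mod int q = (int i + 1 - z) mod int q" for z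
      by (simp add: zmod_int mod_simps algebra_simps)
    ultimately show "h (snd (fsys_prod F ({..<q}, \<lambda>i. Suc i mod q)) x) = snd (fsys_prod F ({..<q}, id)) (h x)"
      using ui by (simp add: fsys_prod_def h_def)
  next
    fix x assume "x \<in> fst (fsys_prod F ({..<q}, id))"
    then obtain u i where ui: "x = (u, i)" "u \<in> fst F" "i < q" by (auto simp: fsys_prod_def)
    show "k x \<in> fst (fsys_prod F ({..<q}, \<lambda>i. Suc i mod q)) \<and> h (k x) = x"
      using ui q by (auto simp: fsys_prod_def h_def k_def nat_less_iff mod_simps)
  qed (simp_all add: wf_fsys_prod wf wf_cycle wfI)
  also have "\<dots> = fdds_of F * of_nat q"
    by (simp add: of_nat_fdds_of times_fdds_of wf wfI)
  finally show ?thesis by (simp add: mult.commute)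
qed

text \<open>No arc leaves a level set of \<open>c\<close>, so the level sets are disjoint subsystems
  and can be split off one at a time.\<close>

lemma fdds_of_partition:
  fixes c :: "'a \<Rightarrow> nat"
  assumes wf: "wf_fsys F" and c: "\<And>u. u \<in> fst F \<Longrightarrow> c (snd F u) = c u"
  shows "fdds_of ({u \<in> fst F. c u < n}, snd F) = (\<Sum>i<n. fdds_of ({u \<in> fst F. c u = i}, snd F))"
proof (induction n)
  case 0
  then show ?case by (simp flip: zero_fdds_of)
next
  case (Suc n)
  have wf': "wf_fsys ({u \<in> fst F. P (c u)}, snd F)" for P
    using wf c by (auto simp: wf_fsys_def)
  let ?L = "({u \<in> fst F. c u < n}, snd F)" and ?N = "({u \<in> fst F. c u = n}, snd F)"
  note wfs = wf'[of "\<lambda>i. i < n"] wf'[of "\<lambda>i. i = n"]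
  have "fdds_of ({u \<in> fst F. c u < Suc n}, snd F) = fdds_of (fsys_sum ?L ?N)"
    by (rule fdds_of_eqI[where k = "case_sum id id" and h = "\<lambda>u. if c u < n then Inl u else Inr u"])
       (use c wf'[of "\<lambda>i. i < Suc n"] wf_fsys_sum[OF wfs] in \<open>auto simp: fsys_sum_def\<close>)
  also have "\<dots> = fdds_of ?L + fdds_of ?N" by (simp add: plus_fdds_of wfs)
  finally show ?case using Suc by simp
qed

subsection \<open>The separating pair\<close>

text \<open>The positive and the negative part of the formal product of \<open>q - C\<^sub>q\<close> over \<open>2 \<le> q \<le> n + 1\<close>.\<close>

fun cycle_diff_prod :: "nat \<Rightarrow> fdds \<times> fdds" where
  "cycle_diff_prod 0 = (1, 0)"
| "cycle_diff_prod (Suc n) = (case cycle_diff_prod n of (X, Y) \<Rightarrow>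
     (of_nat (n + 2) * X + cycle_fdds (n + 2) * Y, cycle_fdds (n + 2) * X + of_nat (n + 2) * Y))"

definition equalized :: "fdds \<Rightarrow> nat \<Rightarrow> bool" where
  "equalized A n \<longleftrightarrow> A * fst (cycle_diff_prod n) = A * snd (cycle_diff_prod n)"

text \<open>The term \<open>of_nat (n + 2) * X\<close> keeps a fixed point in the first component.
  In the second, the cycle factor removes those of \<open>X\<close>, and \<open>Y\<close> has none
  to contribute.\<close>

lemma contains_dendron_cycle_diff_prod:
  "contains_dendron (fst (cycle_diff_prod n)) \<and> \<not> contains_dendron (snd (cycle_diff_prod n))"
  by (induction n) (auto simp: contains_dendron_cycle split_beta simp del: of_nat_Suc of_nat_add)

text \<open>Exchanging \<open>X\<close> and \<open>Y\<close> exchanges the two new components, and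
  \<open>A\<close> does not see this exchange.\<close>

lemma equalized_Suc: "equalized A n \<Longrightarrow> equalized A (Suc n)"
  by (simp add: equalized_def split_beta distrib_left mult.left_commute[of A] add.commute
      del: of_nat_Suc of_nat_add)

lemma equalized_mono: "m \<le> n \<Longrightarrow> equalized A m \<Longrightarrow> equalized A n"
  by (induction rule: dec_induct) (auto intro: equalized_Suc)

text \<open>At the stage that introduces \<open>q\<close>, multiplication by \<open>A\<close> turns
  the cycle into \<open>q\<close>, so both components become \<open>A * (q * X + q * Y)\<close>,
  whatever \<open>X\<close> and \<open>Y\<close> are. That stage is \<open>q - 1\<close>, hence the
  bound on \<open>q\<close>.\<close>

lemma equalized_cycle:
  assumes "A * cycle_fdds q = of_nat q * A" "2 \<le> q" "q \<le> n + 1"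
  shows "equalized A n"
proof -
  obtain m where m: "q = m + 2" using assms(2) by (metis add.commute le_Suc_ex)
  have AC: "A * (cycle_fdds q * Z) = A * (of_nat q * Z)" for Z
    using assms(1) by (metis mult.assoc mult.commute)
  have "equalized A (Suc m)"
    unfolding equalized_def using AC
    by (simp only: cycle_diff_prod.simps split_beta distrib_left fst_conv snd_conv m)
  then show ?thesis using equalized_mono[of "Suc m" n] m assms(3) by simp
qed

text \<open>\<open>A\<close> is split by eventual period. Without a fixed point all periods are at
  least 2, and being bounded, they all occur among the cycle factors from some stage on.\<close>

lemma eventually_equalized:
  assumes "\<not> contains_dendron A"
  shows "eventually (equalized A) sequentially"
proof -
  obtain F :: "nat fsys" where wf: "wf_fsys F" and A: "A = fdds_of F" by (rule fdds_of_cases)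
  let ?f = "snd F" and ?c = "eventual_period (snd F)"
  let ?B = "\<lambda>i. fdds_of ({u \<in> fst F. ?c u = i}, snd F)"
  have F: "finite (fst F)" "?f \<in> fst F \<rightarrow> fst F" using wf by (auto simp: wf_fsys_def)
  have c2: "2 \<le> ?c u" if u: "u \<in> fst F" for u
  proof (rule ccontr)
    assume "\<not> 2 \<le> ?c u"
    then have "?c u = 1" using eventual_period(1)[OF F u] by simp
    then obtain k where "(?f ^^ (k + 1)) u = (?f ^^ k) u"
      using eventual_period(2)[OF F u] by (auto simp: periodic_eventually_def)
    then have "?f ((?f ^^ k) u) = (?f ^^ k) u" by simp
    then show False
      using assms funpow_in[OF F(2) u, of k] by (auto simp: A contains_dendron_fdds_of[OF wf])
  qed
  have "finite (?c ` fst F)" using F(1) by simp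
  then obtain M where M: "\<And>u. u \<in> fst F \<Longrightarrow> ?c u < M"
    using finite_nat_set_iff_bounded by auto
  have wfB: "wf_fsys ({u \<in> fst F. ?c u = i}, snd F)" for i
    using wf by (auto simp: wf_fsys_def eventual_period_step)
  have eqB: "equalized (?B i) n" if "i < M" "M \<le> n" for i n
  proof (cases "2 \<le> i")
    case True
    have "?B i * cycle_fdds i = of_nat i * ?B i"
      by (rule times_cycle_fdds[OF wfB]) (use True in auto)
    then show ?thesis using True that by (intro equalized_cycle) auto
  next
    case False
    then have "{u \<in> fst F. ?c u = i} = {}" using c2 by auto
    then have "?B i = 0" by (simp only: flip: zero_fdds_of)
    then show ?thesis by (simp add: equalized_def)
  qed
  have "{u \<in> fst F. ?c u < M} = fst F" using M by auto
  then have "A = (\<Sum>i<M. ?B i)"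
    using fdds_of_partition[OF wf, of ?c M] by (simp add: A eventual_period_step)
  then have "equalized A n" if "M \<le> n" for n
    using eqB[OF _ that] by (simp add: equalized_def sum_distrib_right)
  then show ?thesis unfolding eventually_sequentially by blast
qed

text \<open>The factor \<open>a\<close> acts as a catalyst while the factors \<open>x\<close> are
  exchanged for \<open>y\<close> one at a time.\<close>

lemma mult_power_eq:
  fixes a x y :: "'a :: comm_semiring_1"
  assumes "a * x = a * y"
  shows "a * x ^ i = a * y ^ i"
proof (induction i)
  case (Suc i)
  have "a * x ^ Suc i = (a * x ^ i) * x" by (simp add: ac_simps)
  also have "\<dots> = (a * x) * y ^ i" using Suc by (simp add: ac_simps)
  also have "\<dots> = a * y ^ Suc i" using assms by (simp add: ac_simps)
  finally show ?case .
qed simp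

theorem theorem13:
  fixes P :: "fdds poly"
  assumes "\<And>i. i \<ge> 1 \<Longrightarrow> \<not> contains_dendron (coeff P i)"
  shows "\<exists>X Y. X \<noteq> Y \<and> poly P X = poly P Y"
proof -
  \<comment> \<open>Finitely many coefficients share one stage \<open>n\<close>. The range begins at
    1 because the constant term has the same value at both arguments.\<close>
  have "eventually (\<lambda>n. \<forall>i\<in>{1..degree P}. equalized (coeff P i) n) sequentially"
    using assms by (intro eventually_ball_finite) (auto intro: eventually_equalized)
  then obtain n where n: "\<And>i. i \<in> {1..degree P} \<Longrightarrow> equalized (coeff P i) n"
    using eventually_happens'[OF sequentially_bot] by blast
  let ?X = "fst (cycle_diff_prod n)" and ?Y = "snd (cycle_diff_prod n)"
  have "coeff P i * ?X ^ i = coeff P i * ?Y ^ i" if "i \<le> degree P" for i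
  proof (cases "i = 0")
    case False
    then have "equalized (coeff P i) n" using n that by simp
    then show ?thesis unfolding equalized_def by (rule mult_power_eq)
  qed simp
  then have "poly P ?X = poly P ?Y" by (simp add: poly_altdef)
  moreover have "?X \<noteq> ?Y" using contains_dendron_cycle_diff_prod[of n] by metis
  ultimately show ?thesis by blast
qed

end
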